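(* Let $n \geq 30$ and consider the Zeckendorf game on $n$ with $p=6$ players divided into two alliances, one with $4$ players and one with $2$ players (in any positions). Then the $4$-player alliance always has a winning strategy.
   Context: Let $F_1=1$, $F_2=2$, $F_{i+1}=F_i+F_{i-1}$. The Zeckendorf game on $n$ starts with the multiset of $n$ copies of $1$. A move is one of: if the list contains $F_{i-1}$ and $F_i$, replace them by $F_{i+1}$; if the list contains two copies of $F_i$: for $i=1$ replace them by $F_2$; for $i=2$ replace them by $F_1,F_3$; for $i\geq 3$ replace them by $F_{i-2},F_{i+1}$. The game ends when the list is the Zeckendorf decomposition of $n$ (distinct, pairwise non-consecutive Fibonacci numbers); every game terminates. With $p$ players, players $1,\dots,p$ move in cyclic order $1,2,\dots,p,1,2,\dots$ starting with player 1. Players are partitioned into alliances; an alliance wins if the final move (creating the Zeckendorf decomposition) is made by one of its members. An alliance has a winning strategy if its members can choose their moves so that the final move is made by a member no matter what moves the other players make. *)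

theory Defs
  imports "HOL-Library.Multiset" "HOL-Number_Theory.Fib"
begin

text \<open>
  The game uses the Fibonacci numbers with initial values 1, 2, whereas \<^const>\<open>fib\<close>
  starts with 0, 1, 1, 2; hence the index shift. Only indices \<open>i \<ge> 1\<close> are used.
\<close>

definition zfib :: "nat \<Rightarrow> nat" where
  "zfib i = fib (Suc i)"

inductive zmove :: "nat multiset \<Rightarrow> nat multiset \<Rightarrow> bool" where
  combine: "i \<ge> 2 \<Longrightarrow> {#zfib (i - 1), zfib i#} \<subseteq># S \<Longrightarrow>
    zmove S (S - {#zfib (i - 1), zfib i#} + {#zfib (i + 1)#})"
| merge_ones: "{#zfib 1, zfib 1#} \<subseteq># S \<Longrightarrow>
    zmove S (S - {#zfib 1, zfib 1#} + {#zfib 2#})"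
| split_twos: "{#zfib 2, zfib 2#} \<subseteq># S \<Longrightarrow>
    zmove S (S - {#zfib 2, zfib 2#} + {#zfib 1, zfib 3#})"
| split: "i \<ge> 3 \<Longrightarrow> {#zfib i, zfib i#} \<subseteq># S \<Longrightarrow>
    zmove S (S - {#zfib i, zfib i#} + {#zfib (i - 2), zfib (i + 1)#})"

definition zeckendorf_decomp :: "nat \<Rightarrow> nat multiset \<Rightarrow> bool" where
  "zeckendorf_decomp n S \<longleftrightarrow>
     (\<exists>I. finite I \<and> (\<forall>i\<in>I. i \<ge> 1) \<and> (\<forall>i\<in>I. Suc i \<notin> I) \<and>
          S = image_mset zfib (mset_set I)) \<and>
     sum_mset S = n"

text \<open>
  A play on \<open>n\<close>, finished or not, is recorded as the nonempty list of the positions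
  visited so far; move number \<open>k\<close>, counting from 0, leads from \<open>h ! k\<close> to \<open>h ! Suc k\<close>.
\<close>

definition zplay :: "nat \<Rightarrow> nat multiset list \<Rightarrow> bool" where
  "zplay n h \<longleftrightarrow> h \<noteq> [] \<and> hd h = replicate_mset n 1 \<and>
     (\<forall>k. Suc k < length h \<longrightarrow>
        \<not> zeckendorf_decomp n (h ! k) \<and> zmove (h ! k) (h ! Suc k))"

definition mover :: "nat \<Rightarrow> nat \<Rightarrow> nat" where
  "mover p k = k mod p + 1"

text \<open>
  A joint strategy of an alliance \<open>A \<subseteq> {1..p}\<close> maps the play so far to the next
  position. It is only consulted when a member of \<open>A\<close> is to move.
\<close>

type_synonym strategy = "nat multiset list \<Rightarrow> nat multiset"

definition follows :: "nat \<Rightarrow> nat set \<Rightarrow> strategy \<Rightarrow> nat multiset list \<Rightarrow> bool" where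
  "follows p A \<sigma> h \<longleftrightarrow>
     (\<forall>k. Suc k < length h \<longrightarrow> mover p k \<in> A \<longrightarrow> h ! Suc k = \<sigma> (take (Suc k) h))"

definition legal_strategy :: "nat \<Rightarrow> nat \<Rightarrow> nat set \<Rightarrow> strategy \<Rightarrow> bool" where
  "legal_strategy n p A \<sigma> \<longleftrightarrow>
     (\<forall>h. zplay n h \<longrightarrow> follows p A \<sigma> h \<longrightarrow> \<not> zeckendorf_decomp n (last h) \<longrightarrow>
        mover p (length h - 1) \<in> A \<longrightarrow> zmove (last h) (\<sigma> h))"

text \<open>
  A finished play \<open>h\<close> consists of \<open>length h - 1\<close> moves, so its final move has
  number \<open>length h - 2\<close>. The last conjunct excludes infinite plays, so that a final
  move is really made.
\<close>

definition winning_strategy :: "nat \<Rightarrow> nat \<Rightarrow> nat set \<Rightarrow> strategy \<Rightarrow> bool" where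
  "winning_strategy n p A \<sigma> \<longleftrightarrow>
     legal_strategy n p A \<sigma> \<and>
     (\<forall>h. zplay n h \<longrightarrow> follows p A \<sigma> h \<longrightarrow> zeckendorf_decomp n (last h) \<longrightarrow>
        length h \<ge> 2 \<and> mover p (length h - 2) \<in> A) \<and>
     \<not> (\<exists>f. \<forall>m. zplay n (map f [0..<Suc m]) \<and> follows p A \<sigma> (map f [0..<Suc m]))"

definition has_winning_strategy :: "nat \<Rightarrow> nat \<Rightarrow> nat set \<Rightarrow> bool" where
  "has_winning_strategy n p A \<longleftrightarrow> (\<exists>\<sigma>. winning_strategy n p A \<sigma>)"

end

theory Submission
  imports Defs "HOL-Number_Theory.Cong"
begin

text \<open>
  The game terminates, so by determinacy either the large alliance can force a win or the two
  opponents can, and the latter is refuted by strategy stealing. If the opponents could force a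
  win from one position \<open>S\<close> both after \<open>t\<close> and after \<open>t + d\<close> moves, where \<open>d\<close> is such that
  opponents never move at two times differing by \<open>d\<close>, then one sequence of moves would be
  consistent with both of their strategies, and its last move would have to be made by opponents
  at two such times. So it suffices that the large alliance can reach one position in
  two ways of different length. Such pairs arise from \<open>2 + 2 \<mapsto> 1 + 3\<close>, \<open>1 + 1 \<mapsto> 2\<close>
  having the same joint effect as the single move \<open>1 + 2 \<mapsto> 3\<close>, and likewise for
  \<open>3 + 3 \<mapsto> 1 + 5\<close>, \<open>1 + 2 \<mapsto> 3\<close> and \<open>2 + 3 \<mapsto> 5\<close>.
  If the opponents are two seats apart, the alliance has three consecutive moves, and this is
  immediate with \<open>d = 1\<close>. If they sit opposite each other or next to each other, only \<open>d\<close> prime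
  to 3, respectively \<open>2 \<le> d \<le> 4\<close>, is possible, and the alliance first produces twos until the
  opponents cannot remove enough of them.
\<close>

subsection \<open>Moves and positions\<close>

lemma zfib_simps: "zfib (Suc 0) = 1" "zfib 1 = 1" "zfib 2 = 2" "zfib 3 = 3" "zfib 4 = 5"
  by (simp_all add: zfib_def numeral_eq_Suc)

lemma zfib_eq_iff:
  assumes "i \<ge> 1" "j \<ge> 1"
  shows "zfib i = zfib j \<longleftrightarrow> i = j"
proof -
  have "strict_mono (\<lambda>k. zfib (Suc k))"
    by (auto simp: strict_mono_Suc_iff zfib_def fib_neq_0_nat)
  from strict_mono_eq[OF this, of "i - 1" "j - 1"] show ?thesis
    using assms by auto
qed

text \<open>\<open>zfib 0\<close> and \<open>zfib 1\<close> are both 1, so the inverse is taken on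
  positive indices only.\<close>

definition zindex :: "nat \<Rightarrow> nat" where
  "zindex x = inv_into {1..} zfib x"

lemma zindex_zfib: "i \<ge> 1 \<Longrightarrow> zindex (zfib i) = i"
  unfolding zindex_def by (rule inv_into_f_f) (auto simp: inj_on_def zfib_eq_iff)

text \<open>
  The weights \<open>4, 7, 9, 11, 13, \<dots>\<close> of \<open>F\<^sub>1, F\<^sub>2, \<dots>\<close> are chosen so that each of the moves strictly
  decreases the total weight.
\<close>

definition weight :: "nat \<Rightarrow> nat" where
  "weight x = (if zindex x = 1 then 4 else 2 * zindex x + 3)"

lemma weight_zfib: "i \<ge> 1 \<Longrightarrow> weight (zfib i) = (if i = 1 then 4 else 2 * i + 3)"
  by (simp add: weight_def zindex_zfib)

lemma sum_image_mset_replace: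
  fixes f :: "'a \<Rightarrow> nat"
  assumes "X \<subseteq># S"
  shows "sum_mset (image_mset f (S - X + Y)) + sum_mset (image_mset f X) =
    sum_mset (image_mset f S) + sum_mset (image_mset f Y)"
proof -
  obtain T where "S = X + T" using assms by (metis subset_mset.add_diff_inverse)
  then show ?thesis by simp
qed

lemma zmove_weight:
  assumes "zmove S S'"
  shows "sum_mset (image_mset weight S') < sum_mset (image_mset weight S)"
  using assms
proof cases
  case (combine i)
  then show ?thesis
    using sum_image_mset_replace[OF combine(3), of weight "{#zfib (i + 1)#}"]
    by (auto simp: weight_zfib split: if_splits)
next
  case merge_ones
  then show ?thesis
    using sum_image_mset_replace[OF merge_ones(2), of weight "{#zfib 2#}"]
    by (auto simp: weight_zfib split: if_splits)
next
  case split_twos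
  then show ?thesis
    using sum_image_mset_replace[OF split_twos(2), of weight "{#zfib 1, zfib 3#}"]
    by (auto simp: weight_zfib split: if_splits)
next
  case (split i)
  then show ?thesis
    using sum_image_mset_replace[OF split(3), of weight "{#zfib (i - 2), zfib (i + 1)#}"]
    by (auto simp: weight_zfib split: if_splits)
qed

text \<open>Requiring Fibonacci parts excludes stuck multisets such as \<open>{#4#}\<close> that are
  not Zeckendorf decompositions.\<close>

definition zposition :: "nat \<Rightarrow> nat multiset \<Rightarrow> bool" where
  "zposition n S \<longleftrightarrow> sum_mset S = n \<and> set_mset S \<subseteq> zfib ` {1..}"

lemma zposition_start: "zposition n (replicate_mset n 1)"
  by (auto simp: zposition_def zfib_simps intro!: image_eqI[of _ _ 1] split: if_splits)

lemma zfib_rec: "i \<ge> 1 \<Longrightarrow> zfib (i + 1) = zfib i + zfib (i - 1)"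
  by (cases i) (auto simp: zfib_def)

lemma zmove_zposition:
  assumes "zmove S S'" "zposition n S"
  shows "zposition n S'"
proof -
  have *: "zposition n (S - X + Y)"
    if "X \<subseteq># S" "sum_mset X = sum_mset Y" "set_mset Y \<subseteq> zfib ` {1..}" for X Y
    using that assms(2) sum_image_mset_replace[OF that(1), of "\<lambda>x. x" Y]
    by (auto simp: zposition_def dest!: in_diffD)
  show ?thesis
    using assms(1)
  proof cases
    case (combine i)
    then have "zfib i + zfib (i - 1) = zfib (i + 1)" using zfib_rec[of i] by simp
    moreover from this have "zfib i + zfib (i - 1) \<in> zfib ` {1..}" by (rule image_eqI) simp
    ultimately show ?thesis unfolding combine(1) using combine(3) by (intro *) auto
  next
    case merge_ones
    have "2 \<in> zfib ` {1..}" using image_eqI[of 2 zfib 2 "{1..}"] by (simp add: zfib_simps)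
    then show ?thesis unfolding merge_ones(1) using merge_ones(2)
      by (intro *) (auto simp: zfib_simps)
  next
    case split_twos
    have "{1, 3} \<subseteq> zfib ` {1..}"
      using image_eqI[of 1 zfib 1 "{1..}"] image_eqI[of 3 zfib 3 "{1..}"] by (simp add: zfib_simps)
    then show ?thesis unfolding split_twos(1) using split_twos(2)
      by (intro *) (auto simp: zfib_simps)
  next
    case (split i)
    have "zfib (i + 1) + zfib (i - 2) = 2 * zfib i"
      using zfib_rec[of i] zfib_rec[of "i - 1"] split by (simp add: numeral_eq_Suc)
    then show ?thesis
      unfolding split(1) using split(2,3) by (intro *) auto
  qed
qed

text \<open>Every move consumes two equal or two consecutive Fibonacci numbers.\<close>

lemma no_zmove_zeckendorf:
  assumes "zeckendorf_decomp n S"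
  shows "\<not> zmove S S'"
proof
  assume mv: "zmove S S'"
  obtain I where I: "finite I" "\<forall>i\<in>I. i \<ge> 1" "\<forall>i\<in>I. Suc i \<notin> I"
      and S: "S = image_mset zfib (mset_set I)"
    using assms unfolding zeckendorf_decomp_def by blast
  have mem: "i \<in> I" if "i \<ge> 1" "zfib i \<in># S" for i
    using that I S zfib_eq_iff by auto
  have "inj_on zfib I" using I(2) by (auto simp: inj_on_def zfib_eq_iff)
  then have "S = mset_set (zfib ` I)" using S by (simp add: image_mset_mset_set)
  then have dup: "\<not> {#x, x#} \<subseteq># S" for x
    using I(1) mset_subset_eq_count[of "{#x, x#}" S x] by (auto simp: count_mset_set' split: if_splits)
  show False
    using mv
  proof cases
    case (combine i)
    then have "i - 1 \<in> I" "i \<in> I"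
      using mem[of i] mem[of "i - 1"] by (auto dest!: set_mset_mono)
    then show False using I(3) combine(2) by (auto dest!: bspec[of _ _ "i - 1"])
  qed (use dup in blast)+
qed

text \<open>In a stuck position, merging and splitting rule out repeated parts and combining rules
  out consecutive ones.\<close>

lemma ex_zmove:
  assumes "zposition n S" "\<not> zeckendorf_decomp n S"
  shows "\<exists>S'. zmove S S'"
proof (rule ccontr)
  assume none: "\<nexists>S'. zmove S S'"
  define I where "I = {i. i \<ge> 1 \<and> zfib i \<in># S}"
  have img: "zfib ` I = set_mset S"
    using assms(1) by (auto simp: zposition_def I_def)
  have inj: "inj_on zfib I" by (auto simp: inj_on_def zfib_eq_iff I_def)
  have fin: "finite I"
    by (rule finite_imageD[OF _ inj]) (simp add: img)
  have "\<not> {#zfib i, zfib i#} \<subseteq># S" if "i \<ge> 1" for i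
  proof -
    consider "i = 1" | "i = 2" | "i \<ge> 3" using \<open>i \<ge> 1\<close> by linarith
    then show ?thesis
      using none zmove.merge_ones zmove.split_twos zmove.split by cases blast+
  qed
  moreover have "{#x, x#} \<subseteq># S" if "count S x \<ge> 2" for x
    using that by (auto simp: subseteq_mset_def)
  moreover have "\<exists>i\<ge>1. x = zfib i" if "x \<in># S" for x
    using assms(1) that unfolding zposition_def by auto
  ultimately have "count S x \<le> 1" if "x \<in># S" for x
    using that by (metis nat_le_linear not_less_eq_eq numeral_2_eq_2 One_nat_def)
  then have "S = mset_set (set_mset S)"
    by (intro multiset_eqI)
      (metis count_greater_eq_one_iff count_mset_set(1,3) finite_set_mset le_antisym not_in_iff)
  then have "S = image_mset zfib (mset_set I)"
    using img inj by (simp add: image_mset_mset_set)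
  moreover have "Suc i \<notin> I" if "i \<in> I" for i
  proof
    assume "Suc i \<in> I"
    have "zfib i \<noteq> zfib (Suc i)" using that zfib_eq_iff[of i "Suc i"] by (simp add: I_def)
    then have "{#zfib i, zfib (Suc i)#} \<subseteq># S"
      using that \<open>Suc i \<in> I\<close> by (auto simp: I_def subseteq_mset_def Suc_le_eq)
    then show False
      using none zmove.combine[of "Suc i" S] that by (auto simp: I_def)
  qed
  ultimately have "zeckendorf_decomp n S"
    unfolding zeckendorf_decomp_def using fin assms(1)
    by (intro conjI exI[of _ I]) (auto simp: zposition_def I_def)
  then show False using assms(2) by contradiction
qed

section \<open>Moves on ones, twos and threes\<close>

lemma zmove_11: "zmove ({#1, 1#} + T) ({#2#} + T)"
  using zmove.merge_ones[of "{#1, 1#} + T"] by (simp add: zfib_simps)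

lemma zmove_22: "zmove ({#2, 2#} + T) ({#1, 3#} + T)"
  using zmove.split_twos[of "{#2, 2#} + T"] by (simp add: zfib_simps)

lemma zmove_33: "zmove ({#3, 3#} + T) ({#1, 5#} + T)"
  using zmove.split[of 3 "{#3, 3#} + T"] by (simp add: zfib_simps)

lemma zmove_12: "zmove ({#1, 2#} + T) ({#3#} + T)"
  using zmove.combine[of 2 "{#1, 2#} + T"] by (simp add: zfib_simps)

lemma zmove_23: "zmove ({#2, 3#} + T) ({#5#} + T)"
  using zmove.combine[of 3 "{#2, 3#} + T"] by (simp add: zfib_simps)


text \<open>Apart from the four moves listed, a move consumes only parts of size at least 3.\<close>

lemma zmove_small_cases:
  assumes "zmove S S'"
  obtains (11) T where "S = {#1, 1#} + T" "S' = {#2#} + T"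
  | (12) T where "S = {#1, 2#} + T" "S' = {#3#} + T"
  | (22) T where "S = {#2, 2#} + T" "S' = {#1, 3#} + T"
  | (23) T where "S = {#2, 3#} + T" "S' = {#5#} + T"
  | (large) "count S 1 \<le> count S' 1" "count S 2 \<le> count S' 2"
proof -
  have decomp: "\<exists>T. S = X + T \<and> S - X + Y = Y + T" if "X \<subseteq># S" for X Y
    using that by (metis add.commute add_diff_cancel_left' subset_mset.add_diff_inverse)
  have gt: "zfib i > 2" if "i \<ge> 3" for i
    using fib_mono[of 4 "Suc i"] that by (simp add: zfib_def numeral_eq_Suc)
  have keep: "count S 1 \<le> count (S - X + Y) 1 \<and> count S 2 \<le> count (S - X + Y) 2"
    if "\<forall>x\<in>#X. x > 2" for X Y
  proof -
    have "count X 1 = 0" "count X 2 = 0" using that by (auto simp: count_eq_zero_iff)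
    then show ?thesis by simp
  qed
  show thesis
    using assms
  proof cases
    case (combine i)
    consider "i = 2" | "i = 3" | "i - 1 \<ge> 3" using combine(2) by linarith
    then show thesis
    proof cases
      case 1
      then have "{#1, 2#} \<subseteq># S" "S' = S - {#1, 2#} + {#3#}"
        using combine(1,3) by (simp_all add: zfib_simps)
      then show ?thesis using 12 decomp by metis
    next
      case 2
      then have "{#2, 3#} \<subseteq># S" "S' = S - {#2, 3#} + {#5#}"
        using combine(1,3) by (simp_all add: zfib_simps)
      then show ?thesis using 23 decomp by metis
    next
      case 3
      have "count S 1 \<le> count S' 1 \<and> count S 2 \<le> count S' 2"
        unfolding combine(1) by (rule keep) (use 3 gt[of i] gt[of "i - 1"] in auto)
      then show ?thesis using large by blast
    qed
  next
    case merge_ones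
    then have "{#1, 1#} \<subseteq># S" "S' = S - {#1, 1#} + {#2#}"
      by (simp_all add: zfib_simps)
    then show thesis using 11 decomp by metis
  next
    case split_twos
    then have "{#2, 2#} \<subseteq># S" "S' = S - {#2, 2#} + {#1, 3#}"
      by (simp_all add: zfib_simps)
    then show thesis using 22 decomp by metis
  next
    case (split i)
    have "count S 1 \<le> count S' 1 \<and> count S 2 \<le> count S' 2"
      unfolding split(1) by (rule keep) (use split(2) gt[of i] in auto)
    then show thesis using large by blast
  qed
qed

lemma zmove_counts:
  assumes "zmove S S'"
  shows "count S 1 = count S' 1 + 2 \<and> count S' 2 = count S 2 + 1 \<and> count S' 3 = count S 3 \<or>
    count S 1 = count S' 1 + 1 \<and> count S 2 = count S' 2 + 1 \<and> count S' 3 = count S 3 + 1 \<or>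
    count S' 1 = count S 1 + 1 \<and> count S 2 = count S' 2 + 2 \<and> count S' 3 = count S 3 + 1 \<or>
    count S' 1 = count S 1 \<and> count S 2 = count S' 2 + 1 \<and> count S 3 = count S' 3 + 1 \<or>
    count S 1 \<le> count S' 1 \<and> count S 2 \<le> count S' 2"
  using assms by (cases rule: zmove_small_cases) auto

subsection \<open>Determinacy and winning strategies\<close>

locale zgame =
  fixes n p :: nat and A :: "nat set"
begin

abbreviation own :: "nat \<Rightarrow> bool" where
  "own t \<equiv> mover p t \<in> A"

text \<open>Backward induction. \<open>t\<close> counts the moves made so far, so a finished
  position at time \<open>Suc t\<close> results from move number \<open>t\<close>.\<close>

inductive wins :: "nat \<Rightarrow> nat multiset \<Rightarrow> bool" where
  final: "zeckendorf_decomp n S \<Longrightarrow> own t \<Longrightarrow> wins (Suc t) S"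
| own: "\<not> zeckendorf_decomp n S \<Longrightarrow> own t \<Longrightarrow> zmove S S' \<Longrightarrow> wins (Suc t) S' \<Longrightarrow> wins t S"
| other: "\<not> zeckendorf_decomp n S \<Longrightarrow> \<not> own t \<Longrightarrow>
    (\<And>S'. zmove S S' \<Longrightarrow> wins (Suc t) S') \<Longrightarrow> wins t S"

definition pick :: strategy where
  "pick h = (SOME S'. zmove (last h) S' \<and> wins (length h) S')"

lemma pick:
  assumes "h \<noteq> []" "wins (length h - 1) (last h)" "\<not> zeckendorf_decomp n (last h)"
    "own (length h - 1)"
  shows "zmove (last h) (pick h) \<and> wins (length h) (pick h)"
proof -
  have "\<exists>S'. zmove (last h) S' \<and> wins (length h) S'"
    using assms(2) by cases (use assms in auto)
  then show ?thesis unfolding pick_def by (rule someI_ex)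
qed

lemma wins_play:
  assumes "zplay n h" "follows p A pick h" "wins 0 (replicate_mset n 1)"
  shows "wins (length h - 1) (last h)"
  using assms(1,2)
proof (induction h rule: rev_induct)
  case Nil
  then show ?case by (simp add: zplay_def)
next
  case (snoc S h)
  show ?case
  proof (cases "h = []")
    case True
    then show ?thesis using snoc assms(3) by (simp add: zplay_def)
  next
    case False
    have nth: "(h @ [S]) ! k = h ! k" if "k < length h" for k
      using that by (simp add: nth_append)
    have "zplay n h"
      unfolding zplay_def
    proof (intro conjI allI impI)
      fix k assume "Suc k < length h"
      then show "\<not> zeckendorf_decomp n (h ! k)" "zmove (h ! k) (h ! Suc k)"
        using snoc.prems(1) nth[of k] nth[of "Suc k"] unfolding zplay_def
        by (auto dest!: spec[of _ k])
    qed (use snoc.prems(1) False in \<open>auto simp: zplay_def\<close>)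
    moreover have "follows p A pick h"
      unfolding follows_def
    proof (intro allI impI)
      fix k assume "Suc k < length h" "own k"
      then show "h ! Suc k = pick (take (Suc k) h)"
        using snoc.prems(2) nth[of "Suc k"] unfolding follows_def by auto
    qed
    ultimately have IH: "wins (length h - 1) (last h)" by (rule snoc.IH)
    have last: "(h @ [S]) ! (length h - 1) = last h" and len: "Suc (length h - 1) = length h"
      using False by (simp_all add: nth_append last_conv_nth)
    have step: "\<not> zeckendorf_decomp n (last h)" "zmove (last h) S"
      using snoc.prems(1) last len unfolding zplay_def
      by (metis length_append_singleton lessI nth_append_length)+
    show ?thesis
    proof (cases "own (length h - 1)")
      case True
      have "S = pick h"
        using snoc.prems(2) True len unfolding follows_def
        by (metis append_eq_conv_conj length_append_singleton lessI nth_append_length)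
      then show ?thesis using pick[OF False IH step(1) True] by simp
    next
      case notown: False
      show ?thesis using IH by cases (use step notown len in auto)
    qed
  qed
qed

lemma winning_strategy_if_wins:
  assumes "wins 0 (replicate_mset n 1)"
  shows "has_winning_strategy n p A"
  unfolding has_winning_strategy_def winning_strategy_def
proof (intro exI[of _ pick] conjI allI impI notI)
  show "legal_strategy n p A pick"
    unfolding legal_strategy_def
    using pick wins_play[OF _ _ assms] by (auto simp: zplay_def)
next
  fix h
  assume h: "zplay n h" "follows p A pick h" "zeckendorf_decomp n (last h)"
  from wins_play[OF h(1,2) assms] h(3)
  obtain t where "length h - 1 = Suc t" "own t" by cases auto
  moreover from this have "length h - 2 = t" by simp
  ultimately show "2 \<le> length h" "own (length h - 2)" by auto
next
  assume "\<exists>f. \<forall>m. zplay n (map f [0..<Suc m]) \<and> follows p A pick (map f [0..<Suc m])"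
  then obtain f where f: "\<And>m. zplay n (map f [0..<Suc m])" by blast
  have "zmove (f k) (f (Suc k))" for k
    using f[of "Suc k"] unfolding zplay_def by (auto simp del: upt_Suc dest!: spec[of _ k])
  then have "(f (Suc k), f k) \<in> measure (\<lambda>S. sum_mset (image_mset weight S))" for k
    using zmove_weight by auto
  then show False using wf_iff_no_infinite_down_chain by (metis wf_measure)
qed

subsection \<open>Strategy stealing\<close>

definition lost :: "nat \<Rightarrow> nat multiset \<Rightarrow> bool" where
  "lost t S \<longleftrightarrow> zposition n S \<and> \<not> wins t S"

lemma lost_own: "lost t S \<Longrightarrow> own t \<Longrightarrow> zmove S S' \<Longrightarrow> lost (Suc t) S'"
  unfolding lost_def using no_zmove_zeckendorf zmove_zposition wins.own by blast

text \<open>\<open>S0\<close> only witnesses that the game is not over; the opponents' good answer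
  \<open>S'\<close> may be another move.\<close>

lemma lost_other: "lost t S \<Longrightarrow> \<not> own t \<Longrightarrow> zmove S S0 \<Longrightarrow> \<exists>S'. zmove S S' \<and> lost (Suc t) S'"
  unfolding lost_def using no_zmove_zeckendorf zmove_zposition wins.other by blast

text \<open>
  Both losing games can be continued by the same moves, because at each time at most one of
  them prescribes an answer of the opponents.
\<close>

lemma not_lost_twice:
  assumes "lost (Suc t) S" "lost (Suc t + d) S" "\<And>k. k \<ge> t \<Longrightarrow> own k \<or> own (k + d)"
  shows False
  using assms
proof (induction "sum_mset (image_mset weight S)" arbitrary: t S rule: less_induct)
  case less
  show False
  proof (cases "zeckendorf_decomp n S")
    case True
    \<comment> \<open>A lost finished position received its last move, number \<open>t\<close> or
      \<open>t + d\<close>, from an opponent.\<close>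
    then have "\<not> own t" "\<not> own (t + d)"
      using less.prems(1,2) wins.final[of S] unfolding lost_def by auto
    then show False using less.prems(3)[of t] by simp
  next
    case False
    then obtain S0 where S0: "zmove S S0"
      using ex_zmove less.prems(1) unfolding lost_def by blast
    have "\<exists>S'. zmove S S' \<and> lost (Suc (Suc t)) S' \<and> lost (Suc (Suc t) + d) S'"
    proof -
      consider "own (Suc t)" "own (Suc t + d)" | "own (Suc t)" "\<not> own (Suc t + d)"
        | "\<not> own (Suc t)" "own (Suc t + d)"
        using less.prems(3)[of "Suc t"] by auto
      then show ?thesis
      proof cases
        case 1
        then show ?thesis using lost_own[OF less.prems(1)] lost_own[OF less.prems(2)] S0 by auto
      next
        case 2
        then show ?thesis
          using lost_own[OF less.prems(1)] lost_other[OF less.prems(2) _ S0] by auto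
      next
        case 3
        then show ?thesis
          using lost_other[OF less.prems(1) _ S0] lost_own[OF less.prems(2)] by auto
      qed
    qed
    then obtain S' where "zmove S S'" "lost (Suc (Suc t)) S'" "lost (Suc (Suc t) + d) S'" by blast
    then show False
      using less.hyps[of S' "Suc t"] less.prems(3) zmove_weight by (meson Suc_leD)
  qed
qed

section \<open>Playing on from lost positions\<close>

lemmas lost_11 = lost_own[OF _ _ zmove_11]
  and lost_12 = lost_own[OF _ _ zmove_12]
  and lost_22 = lost_own[OF _ _ zmove_22]
  and lost_23 = lost_own[OF _ _ zmove_23]
  and lost_33 = lost_own[OF _ _ zmove_33]

lemma mset_decomp:
  assumes "\<forall>x\<in>#X. count X x \<le> count S x"
  shows "\<exists>T. S = X + T"
proof -
  have "X \<subseteq># S"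
    using assms by (metis count_eq_zero_iff subseteq_mset_def zero_le)
  then show ?thesis by (metis subset_mset.add_diff_inverse)
qed

lemma ex_zmove_ones: "count S 1 \<ge> 2 \<Longrightarrow> zmove S (S - {#1, 1#} + {#2#})"
  using zmove.merge_ones[of S] by (simp add: zfib_simps subseteq_mset_def)

text \<open>Whoever moves, a move removes at most two ones, so a merge remains available before each
  of the \<open>k\<close> moves.\<close>

lemma lost_advance:
  assumes "lost t S" "count S 1 \<ge> 2 * k"
  shows "\<exists>S'. lost (t + k) S' \<and> count S 1 \<le> count S' 1 + 2 * k"
  using assms(2)
proof (induction k)
  case 0
  then show ?case using assms(1) by auto
next
  case (Suc k)
  then obtain S1 where S1: "lost (t + k) S1" "count S 1 \<le> count S1 1 + 2 * k" by auto
  then have mv: "zmove S1 (S1 - {#1, 1#} + {#2#})" using Suc.prems by (intro ex_zmove_ones) simp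
  obtain S2 where "zmove S1 S2" "lost (Suc (t + k)) S2"
    using lost_own[OF S1(1) _ mv] lost_other[OF S1(1) _ mv] mv by blast
  then show ?case using S1(2) zmove_counts[of S1 S2] by (intro exI[of _ S2]) auto
qed

section \<open>Opponents in neighbouring seats\<close>

text \<open>
  Two moves and four moves lead to the same position: \<open>1 + 2 \<mapsto> 3\<close> twice against
  \<open>2 + 2 \<mapsto> 1 + 3\<close>, \<open>1 + 1 \<mapsto> 2\<close> twice, \<open>2 + 2 \<mapsto> 1 + 3\<close>; and in the case of two threes
  \<open>1 + 1 \<mapsto> 2\<close>, \<open>2 + 3 \<mapsto> 5\<close> against \<open>3 + 3 \<mapsto> 1 + 5\<close>, \<open>1 + 1 \<mapsto> 2\<close> twice, \<open>2 + 2 \<mapsto> 1 + 3\<close>.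
\<close>

lemma not_lost_four_two_if_pair:
  assumes pat: "\<And>k. own (u + k) \<longleftrightarrow> k mod 6 < 4"
    and lost: "lost u S" and cnt: "count S 1 \<ge> 3" "count S 2 \<ge> 2 \<or> count S 3 \<ge> 2"
  shows False
proof -
  have own: "own u" "own (Suc u)" "own (Suc (Suc u))" "own (Suc (Suc (Suc u)))"
    using pat[of 0] pat[of 1] pat[of 2] pat[of "Suc (Suc (Suc 0))"] by simp_all
  have clash: "own k \<or> own (k + 2)" if k: "k \<ge> Suc u" for k
  proof -
    obtain j where "k = u + j" using k by (metis Suc_leD le_iff_add)
    moreover have "j mod 6 < 4 \<or> (j + 2) mod 6 < 4" by presburger
    ultimately show ?thesis using pat[of j] pat[of "j + 2"] by (simp add: add.assoc)
  qed
  have "\<exists>X. lost (Suc (Suc u)) X \<and> lost (Suc (Suc (Suc (Suc u)))) X"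
  proof (cases "count S 2 \<ge> 2")
    case True
    with cnt obtain T where "S = {#1, 1, 1, 2, 2#} + T"
      using mset_decomp[of "{#1, 1, 1, 2, 2#}" S] by auto
    then have l: "lost u ({#1, 1, 1, 2, 2#} + T)" using lost by simp
    from lost_12[of u "{#1, 1, 2#} + T"] l own
    have "lost (Suc u) ({#1, 1, 2, 3#} + T)" by (simp add: add_mset_commute)
    from lost_12[of "Suc u" "{#1, 3#} + T"] this own
    have a: "lost (Suc (Suc u)) ({#1, 3, 3#} + T)" by (simp add: add_mset_commute)
    from lost_22[of u "{#1, 1, 1#} + T"] l own
    have "lost (Suc u) ({#1, 1, 1, 1, 3#} + T)" by (simp add: add_mset_commute)
    from lost_11[of "Suc u" "{#1, 1, 3#} + T"] this own
    have "lost (Suc (Suc u)) ({#1, 1, 2, 3#} + T)" by (simp add: add_mset_commute)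
    from lost_11[of "Suc (Suc u)" "{#2, 3#} + T"] this own
    have "lost (Suc (Suc (Suc u))) ({#2, 2, 3#} + T)" by (simp add: add_mset_commute)
    from lost_22[of "Suc (Suc (Suc u))" "{#3#} + T"] this own
    have "lost (Suc (Suc (Suc (Suc u)))) ({#1, 3, 3#} + T)" by (simp add: add_mset_commute)
    with a show ?thesis by blast
  next
    case False
    with cnt obtain T where "S = {#1, 1, 1, 3, 3#} + T"
      using mset_decomp[of "{#1, 1, 1, 3, 3#}" S] by auto
    then have l: "lost u ({#1, 1, 1, 3, 3#} + T)" using lost by simp
    from lost_11[of u "{#1, 3, 3#} + T"] l own
    have "lost (Suc u) ({#1, 2, 3, 3#} + T)" by (simp add: add_mset_commute)
    from lost_23[of "Suc u" "{#1, 3#} + T"] this own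
    have a: "lost (Suc (Suc u)) ({#1, 3, 5#} + T)" by (simp add: add_mset_commute)
    from lost_33[of u "{#1, 1, 1#} + T"] l own
    have "lost (Suc u) ({#1, 1, 1, 1, 5#} + T)" by (simp add: add_mset_commute)
    from lost_11[of "Suc u" "{#1, 1, 5#} + T"] this own
    have "lost (Suc (Suc u)) ({#1, 1, 2, 5#} + T)" by (simp add: add_mset_commute)
    from lost_11[of "Suc (Suc u)" "{#2, 5#} + T"] this own
    have "lost (Suc (Suc (Suc u))) ({#2, 2, 5#} + T)" by (simp add: add_mset_commute)
    from lost_22[of "Suc (Suc (Suc u))" "{#5#} + T"] this own
    have "lost (Suc (Suc (Suc (Suc u)))) ({#1, 3, 5#} + T)" by (simp add: add_mset_commute)
    with a show ?thesis by blast
  qed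
  then obtain X where "lost (Suc (Suc u)) X" "lost (Suc (Suc u) + 2) X" by auto
  then show False by (rule not_lost_twice) (rule clash)
qed

text \<open>
  The alliance merges ones four times. To leave fewer than two twos and fewer than two threes, the
  opponents must then play \<open>2 + 2 \<mapsto> 1 + 3\<close> and \<open>2 + 3 \<mapsto> 5\<close>, which consumes no ones.
\<close>

lemma four_two_round:
  assumes pat: "\<And>k. own (u + k) \<longleftrightarrow> k mod 6 < 4"
    and lost: "lost u S" and cnt: "count S 1 \<ge> 15"
  shows "\<exists>S'. lost (u + 6) S' \<and> count S 2 < count S' 2 \<and> count S 1 \<le> count S' 1 + 7"
proof -
  have own: "own u" "own (Suc u)" "own (Suc (Suc u))" "own (Suc (Suc (Suc u)))"
    using pat[of 0] pat[of 1] pat[of 2] pat[of "Suc (Suc (Suc 0))"] by simp_all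
  obtain T where S: "S = {#1, 1, 1, 1, 1, 1, 1, 1#} + T"
    using cnt mset_decomp[of "{#1, 1, 1, 1, 1, 1, 1, 1#}" S] by auto
  from lost_11[of u "{#1, 1, 1, 1, 1, 1#} + T"] lost S own
  have "lost (Suc u) ({#1, 1, 1, 1, 1, 1, 2#} + T)" by (simp add: add_mset_commute)
  from lost_11[of "Suc u" "{#1, 1, 1, 1, 2#} + T"] this own
  have "lost (Suc (Suc u)) ({#1, 1, 1, 1, 2, 2#} + T)" by (simp add: add_mset_commute)
  from lost_11[of "Suc (Suc u)" "{#1, 1, 2, 2#} + T"] this own
  have "lost (Suc (Suc (Suc u))) ({#1, 1, 2, 2, 2#} + T)" by (simp add: add_mset_commute)
  from lost_11[of "Suc (Suc (Suc u))" "{#2, 2, 2#} + T"] this own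
  have l4: "lost (u + 4) ({#2, 2, 2, 2#} + T)" by (simp add: add_mset_commute numeral_eq_Suc)
  obtain S1 where mv1: "zmove ({#2, 2, 2, 2#} + T) S1" and l5: "lost (Suc (u + 4)) S1"
    using lost_other[OF l4 _ ex_zmove_ones] pat[of 4] cnt S
    by (auto simp flip: count_greater_zero_iff)
  note c1 = zmove_counts[OF mv1]
  have cT: "count S 1 = count T 1 + 8" "count S 2 = count T 2"
    "count ({#2, 2, 2, 2#} + T) 1 = count T 1"
    "count ({#2, 2, 2, 2#} + T) 2 = count T 2 + 4" "count ({#2, 2, 2, 2#} + T) 3 = count T 3"
    using S by simp_all
  have "count S1 1 \<ge> 2" using c1 cnt cT by linarith
  then obtain S2 where mv2: "zmove S1 S2" and l6: "lost (Suc (Suc (u + 4))) S2"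
    using lost_other[OF l5 _ ex_zmove_ones] pat[of 5] by (auto simp: add.commute)
  note c2 = zmove_counts[OF mv2]
  have l6: "lost (u + 6) S2" using l6 by (simp add: numeral_eq_Suc)
  have pat': "own (u + 6 + k) \<longleftrightarrow> k mod 6 < 4" for k
    using pat[of "6 + k"] by (simp add: add.assoc)
  \<comment> \<open>Of 15 ones, 8 were merged and at most 2 went with each opposing move, which
    leaves the 3 needed for a pair.\<close>
  have "count S2 1 \<ge> 3" using c1 c2 cnt cT by linarith
  then have "count S2 2 \<le> 1" "count S2 3 \<le> 1"
    using not_lost_four_two_if_pair[OF pat' l6] by force+
  \<comment> \<open>Three of the four new twos are gone, and the split returned one of the eight
    ones: hence one more two and the loss of 7.\<close>
  then show ?thesis using l6 c1 c2 cT by (intro exI[of _ S2]) linarith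
qed

text \<open>Two rounds supply the required pair of twos; the first may cost 7 ones and the second
  needs 15.\<close>

lemma not_lost_four_two:
  assumes pat: "\<And>k. own (u + k) \<longleftrightarrow> k mod 6 < 4"
    and lost: "lost u S" and cnt: "count S 1 \<ge> 22"
  shows False
proof -
  have pat1: "own (u + 6 + k) \<longleftrightarrow> k mod 6 < 4" for k
    using pat[of "6 + k"] by (simp add: add.assoc)
  have pat2: "own (u + 6 + 6 + k) \<longleftrightarrow> k mod 6 < 4" for k
    using pat1[of "6 + k"] by (simp add: add.assoc)
  obtain S1 where S1: "lost (u + 6) S1" "count S 2 < count S1 2" "count S 1 \<le> count S1 1 + 7"
    using four_two_round[OF pat lost] cnt by auto
  obtain S2 where "lost (u + 6 + 6) S2" "count S1 2 < count S2 2" "count S1 1 \<le> count S2 1 + 7"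
    using four_two_round[OF pat1 S1(1)] S1(3) cnt by auto
  then show False using not_lost_four_two_if_pair[OF pat2, of S2] S1 cnt by auto
qed

section \<open>Opponents two seats apart\<close>

lemma not_lost_three_one_one_one:
  assumes pat: "\<And>k. own (u + k) \<longleftrightarrow> k mod 6 \<notin> {3, 5}"
    and lost: "lost u S" and cnt: "count S 1 \<ge> 4"
  shows False
proof -
  have own: "own u" "own (Suc u)" "own (Suc (Suc u))"
    using pat[of 0] pat[of 1] pat[of 2] by simp_all
  have clash: "own k \<or> own (k + 1)" if k: "k \<ge> Suc u" for k
  proof -
    obtain j where "k = u + j" using k by (metis Suc_leD le_iff_add)
    moreover have "j mod 6 \<notin> {3, 5} \<or> (j + 1) mod 6 \<notin> {3, 5}" by (simp; presburger)
    ultimately show ?thesis using pat[of j] pat[of "j + 1"] by (simp add: add.assoc)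
  qed
  obtain T where S: "S = {#1, 1, 1, 1#} + T"
    using cnt mset_decomp[of "{#1, 1, 1, 1#}" S] by auto
  \<comment> \<open>Four ones become \<open>{#1, 3#}\<close> in two moves, or in three by merging
    twice and splitting.\<close>
  from lost_11[of u "{#1, 1#} + T"] lost S own
  have l1: "lost (Suc u) ({#1, 1, 2#} + T)" by (simp add: add_mset_commute)
  from lost_12[of "Suc u" "{#1#} + T"] this own
  have a: "lost (Suc (Suc u)) ({#1, 3#} + T)" by (simp add: add_mset_commute)
  from lost_11[of "Suc u" "{#2#} + T"] l1 own
  have "lost (Suc (Suc u)) ({#2, 2#} + T)" by (simp add: add_mset_commute)
  from lost_22[of "Suc (Suc u)" T] this own
  have "lost (Suc (Suc (Suc u))) ({#1, 3#} + T)" by (simp add: add_mset_commute)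
  then have "lost (Suc (Suc u) + 1) ({#1, 3#} + T)" by simp
  with a show False by (rule not_lost_twice) (rule clash)
qed

section \<open>Opponents in opposite seats\<close>

lemma two_one_clash:
  assumes pat: "\<And>k. own (u + k) \<longleftrightarrow> k mod 3 < 2" and "k \<ge> u"
  shows "own k \<or> own (k + 1)"
proof -
  obtain j where "k = u + j" using assms(2) by (metis le_iff_add)
  moreover have "j mod 3 < 2 \<or> (j + 1) mod 3 < 2" by presburger
  ultimately show ?thesis using pat[of j] pat[of "j + 1"] by (simp add: add.assoc)
qed

text \<open>The alliance merges twice. Any answer other than splitting twos removes at most one two
  and at most two ones.\<close>

lemma two_one_round:
  assumes pat: "\<And>k. own (u + k) \<longleftrightarrow> k mod 3 < 2"
    and lost: "lost u S" and cnt: "count S 1 \<ge> 6"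
  shows "\<exists>S'. lost (u + 3) S' \<and> count S 2 < count S' 2 \<and> count S 1 \<le> count S' 1 + 6"
proof -
  have own: "own u" "own (Suc u)" "\<not> own (Suc (Suc u))"
    using pat[of 0] pat[of 1] pat[of 2] by simp_all
  obtain T where S: "S = {#1, 1, 1, 1#} + T"
    using cnt mset_decomp[of "{#1, 1, 1, 1#}" S] by auto
  from lost_11[of u "{#1, 1#} + T"] lost S own
  have l1: "lost (Suc u) ({#1, 1, 2#} + T)" by (simp add: add_mset_commute)
  from lost_12[of "Suc u" "{#1#} + T"] this own
  have a: "lost (Suc (Suc u)) ({#1, 3#} + T)" by (simp add: add_mset_commute)
  from lost_11[of "Suc u" "{#2#} + T"] l1 own
  have "lost (Suc (Suc u)) ({#2, 2#} + T)" by (simp add: add_mset_commute)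
  \<comment> \<open>Two of the six ones remain, so the opponent does have a move.\<close>
  then obtain S' where mv: "zmove ({#2, 2#} + T) S'" and l3: "lost (Suc (Suc (Suc u))) S'"
    using lost_other[OF _ own(3) ex_zmove_ones, of "{#2, 2#} + T"] cnt S by auto
  \<comment> \<open>Splitting the twos would give a position that the alliance could reach a move earlier.\<close>
  have ne: "S' \<noteq> {#1, 3#} + T"
    using a l3 not_lost_twice[of "Suc u" "{#1, 3#} + T" 1] two_one_clash[OF pat] by auto
  have "count S 2 < count S' 2 \<and> count S 1 \<le> count S' 1 + 6"
    using mv
  proof (cases rule: zmove_small_cases)
    case (22 U)
    then show ?thesis using ne by simp
  next
    case (11 U)
    show ?thesis
      using S 11(2) arg_cong[OF 11(1), of "\<lambda>M. count M 1"] arg_cong[OF 11(1), of "\<lambda>M. count M 2"]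
      by simp
  next
    case (12 U)
    show ?thesis
      using S 12(2) arg_cong[OF 12(1), of "\<lambda>M. count M 1"] arg_cong[OF 12(1), of "\<lambda>M. count M 2"]
      by simp
  next
    case (23 U)
    show ?thesis
      using S 23(2) arg_cong[OF 23(1), of "\<lambda>M. count M 1"] arg_cong[OF 23(1), of "\<lambda>M. count M 2"]
      by simp
  next
    case large
    then show ?thesis using S by simp
  qed
  then show ?thesis using l3 by (intro exI[of _ S']) (simp add: numeral_eq_Suc)
qed

text \<open>Two rounds leave two twos and a one. Then \<open>{#2, 3#}\<close> arises from
  \<open>{#1, 2, 2#}\<close> by one combination, or by a split followed by a merge.\<close>

lemma not_lost_two_one:
  assumes pat: "\<And>k. own (u + k) \<longleftrightarrow> k mod 3 < 2"
    and lost: "lost u S" and cnt: "count S 1 \<ge> 13"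
  shows False
proof -
  have pat1: "own (u + 3 + k) \<longleftrightarrow> k mod 3 < 2" for k
    using pat[of "3 + k"] by (simp add: add.assoc)
  have pat2: "own (u + 3 + 3 + k) \<longleftrightarrow> k mod 3 < 2" for k
    using pat1[of "3 + k"] by (simp add: add.assoc)
  obtain S1 where S1: "lost (u + 3) S1" "count S 2 < count S1 2" "count S 1 \<le> count S1 1 + 6"
    using two_one_round[OF pat lost] cnt by auto
  define v where "v = u + 3 + 3"
  obtain S2 where S2: "lost v S2" "count S1 2 < count S2 2" "count S1 1 \<le> count S2 1 + 6"
    using two_one_round[OF pat1 S1(1)] S1(3) cnt unfolding v_def by auto
  have own: "own v" "own (Suc v)" using pat2[of 0] pat2[of 1] by (simp_all add: v_def)
  obtain T where "S2 = {#1, 2, 2#} + T"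
    using S1 S2 cnt mset_decomp[of "{#1, 2, 2#}" S2]
    by (auto simp flip: count_greater_zero_iff)
  with S2 have l: "lost v ({#1, 2, 2#} + T)" by simp
  from lost_12[of v "{#2#} + T"] l own
  have a: "lost (Suc v) ({#2, 3#} + T)" by (simp add: add_mset_commute)
  from lost_22[of v "{#1#} + T"] l own
  have "lost (Suc v) ({#1, 1, 3#} + T)" by (simp add: add_mset_commute)
  from lost_11[of "Suc v" "{#3#} + T"] this own
  have "lost (Suc (Suc v)) ({#2, 3#} + T)" by (simp add: add_mset_commute)
  with a show False
    using not_lost_twice[of v _ 1] two_one_clash[OF pat2] unfolding v_def by auto
qed

end

subsection \<open>Six players\<close>

text \<open>Start the count at \<open>u\<close>, just after an opponent's turn, so that offset 5 is
  an opponent. Choosing which opponent makes the other offset \<open>c\<close> equal to 4, 3 or 2,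
  for cyclic distance 1, 2 or 3.\<close>

lemma mover_6_cases:
  assumes "A \<union> B = {1..6}" "A \<inter> B = {}" "card B = 2"
  shows "\<exists>u<6. (\<forall>k. mover 6 (u + k) \<in> A \<longleftrightarrow> k mod 6 < 4) \<or>
    (\<forall>k. mover 6 (u + k) \<in> A \<longleftrightarrow> k mod 6 \<notin> {3, 5}) \<or>
    (\<forall>k. mover 6 (u + k) \<in> A \<longleftrightarrow> k mod 3 < 2)"
proof -
  obtain x y where B: "B = {x, y}" "x \<noteq> y" using assms(3) by (auto simp: card_2_iff)
  have xy: "x \<in> {1..6}" "y \<in> {1..6}" using assms(1) B by auto
  have *: "mover 6 t \<in> A \<longleftrightarrow> t mod 6 + 1 \<noteq> x \<and> t mod 6 + 1 \<noteq> y" for t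
  proof -
    have "t mod 6 + 1 \<in> A \<union> B" using assms(1) by (simp add: Suc_le_eq)
    then show ?thesis using assms(2) B(1) unfolding mover_def by blast
  qed
  have shift: "(u + k) mod 6 = (u + c) mod 6 \<longleftrightarrow> k mod 6 = c" if "c < 6" for u k c :: nat
    using cong_add_lcancel_nat[of u k c 6] that by (simp add: cong_def)
  have "\<exists>u\<in>{0, 1, 2, 3, 4, 5}. \<exists>c\<in>{4, 3, 2}.
      x = (u + c) mod 6 + 1 \<and> y = (u + 5) mod 6 + 1 \<or> y = (u + c) mod 6 + 1 \<and> x = (u + 5) mod 6 + 1"
  proof -
    have "x \<in> {1, 2, 3, 4, 5, 6}" "y \<in> {1, 2, 3, 4, 5, 6}" using xy by auto
    then show ?thesis using B(2) by (elim insertE emptyE) simp_all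
  qed
  then obtain u c where "u \<in> {0, 1, 2, 3, 4, 5}" and c: "c \<in> {4, 3, 2}" and xy_eq:
    "x = (u + c) mod 6 + 1 \<and> y = (u + 5) mod 6 + 1 \<or> y = (u + c) mod 6 + 1 \<and> x = (u + 5) mod 6 + 1"
    by (elim bexE) (rule that)
  then have u: "u < 6" by auto
  have **: "mover 6 (u + k) \<in> A \<longleftrightarrow> k mod 6 \<noteq> c \<and> k mod 6 \<noteq> 5" for k
    using xy_eq c shift[of c u k] shift[of 5 u k] unfolding * by auto
  have "k mod 6 \<noteq> 4 \<and> k mod 6 \<noteq> 5 \<longleftrightarrow> k mod 6 < 4" "k mod 6 \<noteq> 2 \<and> k mod 6 \<noteq> 5 \<longleftrightarrow> k mod 3 < 2"
    for k :: nat
    by presburger+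
  with u c ** show ?thesis by (intro exI[of _ u]) auto
qed

theorem theorem1p3p3:
  fixes n p :: nat and A B :: "nat set"
  assumes "n \<ge> 30"
    and "p = 6"
    and "A \<union> B = {1..p}" and "A \<inter> B = {}"
    and "card A = 4" and "card B = 2"
  shows "has_winning_strategy n p A"
proof (rule ccontr)
  interpret zgame n 6 A .
  assume "\<not> has_winning_strategy n p A"
  then have lost0: "lost 0 (replicate_mset n 1)"
    using winning_strategy_if_wins zposition_start unfolding lost_def assms(2) by blast
  obtain u where u: "u < 6" and "(\<forall>k. own (u + k) \<longleftrightarrow> k mod 6 < 4) \<or>
    (\<forall>k. own (u + k) \<longleftrightarrow> k mod 6 \<notin> {3, 5}) \<or> (\<forall>k. own (u + k) \<longleftrightarrow> k mod 3 < 2)"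
    using mover_6_cases[of A B] assms by auto
  then consider (four) "u < 5" "\<forall>k. own (u + k) \<longleftrightarrow> k mod 6 < 4"
    | (three) "u = 5" "\<forall>k. own (u + k) \<longleftrightarrow> k mod 6 < 4"
    | (alternating) "\<forall>k. own (u + k) \<longleftrightarrow> k mod 6 \<notin> {3, 5}"
    | (opposite) "\<forall>k. own (u + k) \<longleftrightarrow> k mod 3 < 2"
    using less_Suc_eq[of u 5] by auto
  then show False
  proof cases
    case four
    \<comment> \<open>Here \<open>u\<close> is at most 4, and 30 - 8 = 22 ones suffice.\<close>
    obtain S where S: "lost u S" "n \<le> count S 1 + 2 * u"
      using lost_advance[OF lost0, of u] u assms(1) by auto
    then show False
      using not_lost_four_two[OF four(2)[rule_format] S(1)] four(1) assms(1) by linarith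
  next
    case three
    have own: "own 0" "own 1" "own 2"
      \<comment> \<open>Offsets 1, 2, 3 from \<open>u = 5\<close> are times 6, 7, 8, that is, seats
        of times 0, 1, 2.\<close>
      using three(2)[rule_format, of 1] three(2)[rule_format, of 2] three(2)[rule_format, of 3] three(1)
      by (simp_all add: mover_def)
    obtain T where T: "replicate_mset n (1::nat) = {#1, 1, 1, 1#} + T"
      using assms(1) mset_decomp[of "{#1, 1, 1, 1#}" "replicate_mset n (1::nat)"] by auto
    have cnt: "n = count T 1 + 4"
      using arg_cong[OF T, of "\<lambda>M. count M 1"] by simp
    from lost_11[of 0 "{#1, 1#} + T"] lost0 T own
    have "lost 1 ({#1, 1, 2#} + T)" by (simp add: add_mset_commute)
    from lost_11[of 1 "{#2#} + T"] this own
    have "lost 2 ({#2, 2#} + T)" by (simp add: add_mset_commute numeral_eq_Suc)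
    \<comment> \<open>A third merging of ones could leave only 20 of them after the opponents' moves.\<close>
    from lost_22[of 2 T] this own
    have "lost 3 ({#1, 3#} + T)" by (simp add: numeral_eq_Suc)
    \<comment> \<open>The split restored a one, so at least 30 - 4 + 1 - 4 = 23 ones survive the
      opponents' moves at times 3 and 4.\<close>
    then obtain S where S: "lost u S" "count T 1 + 1 \<le> count S 1 + 2 * 2"
      using lost_advance[of 3 "{#1, 3#} + T" 2] cnt assms(1) three(1) by auto
    then show False
      using not_lost_four_two[OF three(2)[rule_format] S(1)] cnt assms(1) by linarith
  next
    case alternating
    obtain S where S: "lost u S" "n \<le> count S 1 + 2 * u"
      using lost_advance[OF lost0, of u] u assms(1) by auto
    then show False
      using not_lost_three_one_one_one[OF alternating[rule_format] S(1)] u assms(1) by linarith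
  next
    case opposite
    obtain S where S: "lost u S" "n \<le> count S 1 + 2 * u"
      using lost_advance[OF lost0, of u] u assms(1) by auto
    then show False using not_lost_two_one[OF opposite[rule_format] S(1)] u assms(1) by linarith
  qed
qed

end
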